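(* Let $w$ be an infinite word. If for each $n\geq 1$ the symmetry group $G_n(w)$ contains the cycle $(1\,2\,\dots\,n)$, then $w$ is universal. In particular, $G_n(w)=S_n$ for each $n$.
   Context: An infinite word is a one-sided sequence $w=w_1w_2\cdots$ of letters from a finite alphabet. $F(w)$ denotes the set of all (finite) factors of $w$ and $F_n(w)$ the set of factors of length $n$. A permutation $g\in S_n$ acts on a word $u=u_1\cdots u_n$ by $g(u)=u_{g^{-1}(1)}\cdots u_{g^{-1}(n)}$. The symmetry group of order $n$ of $w$ is $G_n(w)=\{\pi\in S_n \mid \pi(x)\in F_n(w)\text{ for each }x\in F_n(w)\}$. The cycle $(m_1m_2\ldots m_k)$ is the permutation sending $m_i$ to $m_{i+1}$ (and $m_k$ to $m_1$). The word $w$ is universal if $F(w)=\Sigma^*$, where $\Sigma$ is the set of letters occurring in $w$. *)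

theory Defs
  imports "HOL-Library.Omega_Words_Fun" "HOL-Combinatorics.Cycles"
begin

text \<open>
  The letters of an infinite word are indexed from \<open>0\<close>, as in the library; positions inside a finite
  word are numbered from \<open>1\<close>, so that the symmetric group of degree \<open>n\<close> consists of the permutations
  of \<open>{1..n}\<close>.
\<close>

definition factors :: "'a word \<Rightarrow> 'a list set" where
  "factors w = {w[i \<rightarrow> j] | i j. i \<le> j}"

definition factors_of_length :: "nat \<Rightarrow> 'a word \<Rightarrow> 'a list set" where
  "factors_of_length n w = {u \<in> factors w. length u = n}"

text \<open>
  The letter of \<open>perm_action g u\<close> at position \<open>i\<close> is the letter of \<open>u\<close> at position \<open>inv g i\<close>;
  the subtraction converts to the \<open>0\<close>-based indexing of lists.
\<close>

definition perm_action :: "(nat \<Rightarrow> nat) \<Rightarrow> 'a list \<Rightarrow> 'a list" where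
  "perm_action g u = map (\<lambda>i. u ! (inv g i - 1)) [1..<Suc (length u)]"

definition symmetric_perms :: "nat \<Rightarrow> (nat \<Rightarrow> nat) set" where
  "symmetric_perms n = {g. g permutes {1..n}}"

definition symmetry_group :: "nat \<Rightarrow> 'a word \<Rightarrow> (nat \<Rightarrow> nat) set" where
  "symmetry_group n w =
     {g \<in> symmetric_perms n. \<forall>x \<in> factors_of_length n w. perm_action g x \<in> factors_of_length n w}"

definition universal :: "'a word \<Rightarrow> bool" where
  "universal w \<longleftrightarrow> factors w = lists (range w)"

end

(*
  Rotating a long factor u z shows that u recurs arbitrarily far to the right, since z u is a
  factor too. Hence for factors u and v some v z u is a factor; its rotation u v z shows that u v is
  a factor. So the factors are closed under concatenation and contain every word over the letters
  of w.
*)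
theory Submission
  imports Defs
begin

lemma subsequence_join:
  fixes w :: "'a word"
  assumes "i \<le> j" "j \<le> k"
  shows "w[i \<rightarrow> j] @ w[j \<rightarrow> k] = w[i \<rightarrow> k]"
  using assms upt_add_eq_append[of i j "k - j"] by (simp add: subsequence_def flip: map_append)

lemma subsequence_in_factors: "i \<le> j \<Longrightarrow> w[i \<rightarrow> j] \<in> factors w"
  unfolding factors_def by blast

text \<open>With the length prescribed, an occurrence is determined by its starting index
  alone.\<close>

lemma factors_iff: "u \<in> factors w \<longleftrightarrow> (\<exists>i. u = w[i \<rightarrow> i + length u])"
proof
  assume "u \<in> factors w"
  then obtain i j where "u = w[i \<rightarrow> j]" "i \<le> j"
    by (auto simp: factors_def)
  then show "\<exists>i. u = w[i \<rightarrow> i + length u]"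
    by (intro exI[of _ i]) simp
next
  assume "\<exists>i. u = w[i \<rightarrow> i + length u]"
  then obtain i where "u = w[i \<rightarrow> i + length u]" ..
  then show "u \<in> factors w"
    by (metis subsequence_in_factors le_add1)
qed

lemma Nil_in_factors: "[] \<in> factors w"
  by (simp add: factors_iff)

lemma singleton_in_factors: "[w i] \<in> factors w"
  by (auto simp: factors_iff intro!: exI[of _ i])

lemma factors_subset_lists: "factors w \<subseteq> lists (range w)"
  by (auto simp: factors_def)

lemma factors_appendD:
  assumes "u @ v \<in> factors w"
  shows "u \<in> factors w"
proof -
  obtain i where "u @ v = w[i \<rightarrow> i + length (u @ v)]"
    using assms by (auto simp: factors_iff)
  then have "take (length u) (u @ v) = take (length u) (w[i \<rightarrow> i + length (u @ v)])"
    by simp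
  then have "u = w[i \<rightarrow> i + length u]"
    by (simp add: take_map)
  then show ?thesis
    by (auto simp: factors_iff)
qed

lemma cycle_of_list_upt:
  assumes "i < n"
  shows "cycle_of_list [1..<Suc n] (Suc i) = Suc (Suc i mod n)"
proof -
  let ?xs = "[1..<Suc n]"
  \<comment> \<open>The cycle sends each entry of the list to the next one. Entry \<open>i\<close>
    of \<open>?xs\<close> is \<open>Suc i\<close>, hence the outer \<open>Suc\<close> on both sides
    of the claim.\<close>
  have "map (cycle_of_list ?xs) ?xs = rotate1 ?xs"
    using cyclic_rotation[of ?xs 1] by simp
  then have "map (cycle_of_list ?xs) ?xs ! i = rotate1 ?xs ! i"
    by simp
  then show ?thesis
    using assms by (simp add: nth_rotate1 del: upt_Suc)
qed

lemma inv_cycle_of_list_upt: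
  assumes "i < n"
  shows "inv (cycle_of_list [1..<Suc n]) (Suc i) = (if i = 0 then n else i)"
proof -
  let ?c = "cycle_of_list [1..<Suc n]"
  \<comment> \<open>The predecessor of position \<open>Suc i\<close> on the cycle; for
    \<open>i = 0\<close> the cycle wraps around from \<open>n\<close> to 1.\<close>
  have "?c (if i = 0 then n else i) = Suc i"
    using assms cycle_of_list_upt[of "i - 1" n] cycle_of_list_upt[of "n - 1" n]
    by (cases "i = 0") (simp_all del: upt_Suc)
  moreover have "inj ?c"
    using cycle_permutes[of "[1..<Suc n]"] permutes_inj by blast
  ultimately show ?thesis
    by (simp only: inv_f_eq)
qed

text \<open>The inverse cycle reads position 1 from the last position and every other position from
  its predecessor, so the last letter moves to the front.\<close>

lemma perm_action_cycle:
  "perm_action (cycle_of_list [1..<Suc (Suc (length u))]) (u @ [a]) = a # u"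
proof (rule nth_equalityI)
  let ?c = "cycle_of_list [1..<Suc (Suc (length u))]"
  fix i
  assume "i < length (perm_action ?c (u @ [a]))"
  then have i: "i < Suc (length u)"
    by (simp add: perm_action_def del: upt_Suc)
  then have "perm_action ?c (u @ [a]) ! i = (u @ [a]) ! (inv ?c (Suc i) - 1)"
    by (simp add: perm_action_def del: upt_Suc)
  also have "\<dots> = (a # u) ! i"
    using i by (cases i) (simp_all only: inv_cycle_of_list_upt, simp_all add: nth_append)
  finally show "perm_action ?c (u @ [a]) ! i = (a # u) ! i" .
qed (simp add: perm_action_def del: upt_Suc)

lemma set_perm_action_subset:
  assumes "g permutes {1..length u}"
  shows "set (perm_action g u) \<subseteq> set u"
proof -
  have "u ! (inv g i - 1) \<in> set u" if "i \<in> {1..length u}" for i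
  proof -
    have "inv g i \<in> {1..length u}"
      using that permutes_in_image[OF permutes_inv[OF assms]] by blast
    then show ?thesis
      by (auto intro!: nth_mem)
  qed
  then show ?thesis
    by (auto simp: perm_action_def simp del: upt_Suc)
qed

text \<open>Permuting positions introduces no new letter, and in a universal word every word of
  length \<open>n\<close> over its letters is a factor.\<close>

lemma universal_imp_symmetry_group:
  assumes "universal w"
  shows "symmetry_group n w = symmetric_perms n"
proof -
  have "perm_action g u \<in> factors_of_length n w"
    if "g permutes {1..n}" and "u \<in> factors_of_length n w" for g u
  proof -
    have u: "set u \<subseteq> range w" "length u = n"
      using that(2) assms by (auto simp: factors_of_length_def universal_def)
    then have "set (perm_action g u) \<subseteq> range w"
      using set_perm_action_subset[of g u] that(1) by blast
    moreover have "length (perm_action g u) = n"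
      using u(2) by (simp add: perm_action_def del: upt_Suc)
    ultimately show ?thesis
      using assms by (auto simp: factors_of_length_def universal_def)
  qed
  then show ?thesis
    by (auto simp: symmetry_group_def symmetric_perms_def)
qed

text \<open>The cycle whose order is the full length moves one letter from the end to the front;
  this is repeated for each letter of \<open>v\<close>. Each moved letter joins \<open>u\<close>, so
  \<open>u\<close> has to vary in the induction.\<close>

lemma factors_rotate:
  assumes "\<And>n. n \<ge> 1 \<Longrightarrow> cycle_of_list [1..<Suc n] \<in> symmetry_group n w"
    and "u @ v \<in> factors w"
  shows "v @ u \<in> factors w"
  using assms(2)
proof (induction v arbitrary: u rule: rev_induct)
  case Nil
  then show ?case by simp
next
  case (snoc a v)
  have "a # u @ v \<in> factors w"
    using assms(1)[of "Suc (length (u @ v))"] snoc.prems perm_action_cycle[of "u @ v" a]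
    by (auto simp: symmetry_group_def factors_of_length_def simp del: upt_Suc)
  then show ?case
    using snoc.IH[of "a # u"] by simp
qed

lemma factors_append:
  assumes cyc: "\<And>n. n \<ge> 1 \<Longrightarrow> cycle_of_list [1..<Suc n] \<in> symmetry_group n w"
    and "u \<in> factors w" "v \<in> factors w"
  shows "u @ v \<in> factors w"
proof -
  have rot: "y @ x \<in> factors w" if "x @ y \<in> factors w" for x y
    by (rule factors_rotate) (fact cyc, fact that)
  obtain i i' j j' where u: "u = w[i \<rightarrow> i']" "i \<le> i'" and v: "v = w[j \<rightarrow> j']" "j \<le> j'"
    using assms(2,3) unfolding factors_def by blast
  \<comment> \<open>The length \<open>j'\<close> of \<open>z\<close> is the index where the
    occurrence of \<open>v\<close> ends. Wherever \<open>z @ u\<close> occurs, its \<open>u\<close>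
    starts at index \<open>j'\<close> or later, hence not before the end of
    \<open>v\<close>.\<close>
  define z where "z = w[i' \<rightarrow> i' + j']"
  have "u @ z = w[i \<rightarrow> i' + j']"
    using u by (simp add: z_def subsequence_join)
  then have "u @ z \<in> factors w"
    using u(2) by (simp add: subsequence_in_factors trans_le_add1)
  then have "z @ u \<in> factors w"
    by (rule rot)
  then obtain k where k: "z @ u = w[k \<rightarrow> k + length (z @ u)]"
    unfolding factors_iff by blast
  have "length z = j'"
    by (simp add: z_def)
  then have u': "u = w[k + j' \<rightarrow> k + j' + length u]"
    using arg_cong[OF k, of "drop j'"] by (simp add: drop_map add.assoc)
  \<comment> \<open>The gap between the end of \<open>v\<close> and the new occurrence of
    \<open>u\<close>; it is empty if \<open>k = 0\<close>.\<close>
  define y where "y = w[j' \<rightarrow> k + j']"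
  have "v @ y @ w[k + j' \<rightarrow> k + j' + length u] = w[j \<rightarrow> k + j' + length u]"
    using v by (simp add: y_def subsequence_join)
  then have "(v @ y) @ u = w[j \<rightarrow> k + j' + length u]"
    unfolding u'[symmetric] by simp
  then have "(v @ y) @ u \<in> factors w"
    using v(2) by (simp only: subsequence_in_factors trans_le_add1 trans_le_add2)
  \<comment> \<open>Rotation brings \<open>u\<close> directly before \<open>v\<close> and leaves the
    uncontrolled gap \<open>y\<close> as a suffix that can be cut off.\<close>
  then have "(u @ v) @ y \<in> factors w"
    using rot[of "v @ y" u] by simp
  then show ?thesis
    by (rule factors_appendD)
qed

theorem proposition3:
  fixes w :: "'a word"
  assumes "finite (range w)"
    and "\<And>n. n \<ge> 1 \<Longrightarrow> cycle_of_list [1..<Suc n] \<in> symmetry_group n w"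
  shows "universal w \<and> (\<forall>n. symmetry_group n w = symmetric_perms n)"
proof -
  have "u \<in> factors w" if "u \<in> lists (range w)" for u
    using that
  proof (induction u)
    case Nil
    show ?case by (rule Nil_in_factors)
  next
    case (Cons a u)
    then have "[a] \<in> factors w" "u \<in> factors w"
      using singleton_in_factors by auto
    with assms(2) have "[a] @ u \<in> factors w"
      by (rule factors_append)
    then show ?case
      by simp
  qed
  then have "universal w"
    using factors_subset_lists[of w] unfolding universal_def by blast
  then show ?thesis
    by (simp add: universal_imp_symmetry_group)
qed

end
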